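(* Let $M_1=(E_1,r_1)$ and $M_2=(E_2,r_2)$ be $q$-matroids with collections of independent spaces $\mathcal{I}_1$ and $\mathcal{I}_2$, let $\pi_i:E_1\oplus E_2\to E_i$ be the projections and $\iota_i:E_i\to E_1\oplus E_2$ the canonical embeddings ($i=1,2$). Let $\lambda_1(A)=r_1(E_1)-r_1(A)$ for $A\le E_1$ and $\nu_2(B)=\dim(B)-r_2(B)$ for $B\le E_2$. Then the set $$\mathcal{I}:=\{I\leq E_1\oplus E_2:\ \pi_1(I\cap\iota_1(E_1))\in\mathcal{I}_1,\ \lambda_1(\pi_1(I\cap\iota_1(E_1)))\geq\nu_2(\pi_2(I))\}$$ is the collection of independent spaces of a $q$-matroid with ground space $E_1\oplus E_2$.
   Context: Let $\mathbb{F}_q$ be the finite field with $q$ elements. For a finite-dimensional $\mathbb{F}_q$-vector space $E$, $\mathcal{L}(E)$ denotes the lattice of its $\mathbb{F}_q$-subspaces, and $A\le B$ means $A$ is a subspace of $B$. A $q$-matroid with ground space $E$ is a pair $M=(E,r)$ where $r:\mathcal{L}(E)\to\mathbb{Z}$ satisfies: (R1) $0\le r(A)\le\dim(A)$; (R2) $A\le B\Rightarrow r(A)\le r(B)$; (R3) $r(A+B)+r(A\cap B)\le r(A)+r(B)$, for all $A,B\in\mathcal{L}(E)$. A subspace $A$ is independent if $r(A)=\dim(A)$. The collection of independent spaces determines the $q$-matroid uniquely. *)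

theory Defs
  imports "HOL-Analysis.Product_Vector"
begin

text \<open>
  The ground space \<open>E\<close> is a finite-dimensional subspace of an arbitrary ambient vector space over a
  finite field \<open>'a\<close>, so that any finite-dimensional space, and any subspace of one, can serve as
  ground space. Only the values of \<open>r\<close> on subspaces of \<open>E\<close> are meaningful.
\<close>

locale q_matroid = V: vector_space scale
  for scale :: "'a::{field,finite} \<Rightarrow> 'b::ab_group_add \<Rightarrow> 'b" +
  fixes E :: "'b set" and r :: "'b set \<Rightarrow> int"
  assumes subspace_ground: "V.subspace E"
    and finite_dim_ground: "\<exists>B. finite B \<and> V.span B = E"
    and R1: "\<lbrakk>V.subspace A; A \<subseteq> E\<rbrakk> \<Longrightarrow> 0 \<le> r A \<and> r A \<le> int (V.dim A)"
    and R2: "\<lbrakk>V.subspace A; V.subspace B; A \<subseteq> B; B \<subseteq> E\<rbrakk> \<Longrightarrow> r A \<le> r B"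
    and R3: "\<lbrakk>V.subspace A; V.subspace B; A \<subseteq> E; B \<subseteq> E\<rbrakk> \<Longrightarrow>
               r {a + b |a b. a \<in> A \<and> b \<in> B} + r (A \<inter> B) \<le> r A + r B"
begin

definition indep_spaces :: "'b set set"
  where "indep_spaces = {A. V.subspace A \<and> A \<subseteq> E \<and> r A = int (V.dim A)}"

definition conullity :: "'b set \<Rightarrow> int"
  where "conullity A = r E - r A"

definition nullity :: "'b set \<Rightarrow> int"
  where "nullity A = int (V.dim A) - r A"

end

end

theory Submission
  imports Defs
begin

text \<open>
  For \<open>A \<le> E\<^sub>1 \<oplus> E\<^sub>2\<close> put \<open>A\<^sub>1 = \<pi>\<^sub>1(A \<inter> \<iota>\<^sub>1(E\<^sub>1))\<close> and \<open>A\<^sub>2 = \<pi>\<^sub>2(A)\<close>. The required rank function is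
  \<open>min (g A) (h A)\<close> with \<open>g A = r\<^sub>1(E\<^sub>1) + r\<^sub>2(A\<^sub>2)\<close> and \<open>h A = r\<^sub>1(A\<^sub>1) + dim A\<^sub>2\<close>. Since
  \<open>dim A = dim A\<^sub>1 + dim A\<^sub>2\<close>, it equals \<open>dim A\<close> exactly when \<open>A\<^sub>1\<close> is independent and the inequality
  between \<open>\<lambda>\<^sub>1(A\<^sub>1)\<close> and \<open>\<nu>\<^sub>2(A\<^sub>2)\<close> holds. Submodularity of the minimum follows from submodularity of
  \<open>g\<close>, submodularity of \<open>h = dim - \<nu>\<^sub>1\<close>, and the mixed inequality
  \<open>g (A + B) + h (A \<inter> B) \<le> g A + h B\<close>; the last two use that the nullity is monotone.
  The dimension formulas come from counting: a finite subspace \<open>A\<close> has \<open>q\<close> to the power \<open>dim A\<close> elements.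
\<close>

section \<open>Cardinality and dimension over a finite field\<close>

lemma card_eq_card_image_times_card_kernel:
  fixes f :: "'a::ab_group_add \<Rightarrow> 'b::ab_group_add"
  assumes fin: "finite A"
    and add_closed: "\<And>x y. \<lbrakk>x \<in> A; y \<in> A\<rbrakk> \<Longrightarrow> x + y \<in> A"
    and diff_closed: "\<And>x y. \<lbrakk>x \<in> A; y \<in> A\<rbrakk> \<Longrightarrow> x - y \<in> A"
    and add: "\<And>x y. f (x + y) = f x + f y"
  shows "card A = card (f ` A) * card {x \<in> A. f x = 0}"
proof -
  have diff: "f (x - y) = f x - f y" for x y
    using add[of "x - y" y] by (simp add: algebra_simps)
  have fibre: "card {x \<in> A. f x = y} = card {x \<in> A. f x = 0}" if y: "y \<in> f ` A" for y
  proof -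
    obtain a where a: "a \<in> A" "y = f a"
      using y by blast
    \<comment> \<open>A nonempty fibre of an additive map is a translate of the kernel: shift by any
      preimage \<open>a\<close> of \<open>y\<close>.\<close>
    have "bij_betw (\<lambda>x. x + a) {x \<in> A. f x = 0} {x \<in> A. f x = y}"
      by (rule bij_betw_byWitness[where f' = "\<lambda>x. x - a"])
        (use a in \<open>auto simp: add diff add_closed diff_closed\<close>)
    then show ?thesis
      by (rule bij_betw_same_card[symmetric])
  qed
  have "card A = (\<Sum>y\<in>f ` A. card {x \<in> A. f x = y})"
    using sum.image_gen[OF fin, of "\<lambda>_. 1 :: nat" f] by (simp only: card_eq_sum)
  also have "\<dots> = card (f ` A) * card {x \<in> A. f x = 0}"
    using fibre by simp
  finally show ?thesis .
qed

locale finite_field_vector_space = vector_space scale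
  for scale :: "'a::{field,finite} \<Rightarrow> 'b::ab_group_add \<Rightarrow> 'b"
begin

lemma card_scalars_gt_1: "card (UNIV :: 'a set) > 1"
  using card_mono[of "UNIV :: 'a set" "{0, 1}"] by simp

text \<open>Writes the enlarged span as the image of a product with the finite scalar field, which
  gives finiteness by induction and, once the map is known to be injective, the cardinality.\<close>

lemma span_insert_eq_image:
  "span (insert b B) = (\<lambda>(k, x). x + scale k b) ` (UNIV \<times> span B)"
proof (intro equalityI subsetI)
  fix x assume "x \<in> span (insert b B)"
  then obtain k where "x - scale k b \<in> span B"
    by (auto simp: span_breakdown_eq)
  then show "x \<in> (\<lambda>(k, x). x + scale k b) ` (UNIV \<times> span B)"
    by (intro image_eqI[where x = "(k, x - scale k b)"]) auto
next
  fix x assume "x \<in> (\<lambda>(k, x). x + scale k b) ` (UNIV \<times> span B)"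
  then obtain k y where "y \<in> span B" "x = y + scale k b"
    by auto
  then have "x - scale k b \<in> span B"
    by simp
  then show "x \<in> span (insert b B)"
    by (auto simp: span_breakdown_eq)
qed

lemma finite_span:
  assumes "finite B"
  shows "finite (span B)"
  using assms
proof (induction B rule: finite_induct)
  case empty
  then show ?case by simp
next
  case (insert b B)
  then show ?case by (simp add: span_insert_eq_image)
qed

lemma card_span_independent:
  assumes "finite B" "independent B"
  shows "card (span B) = card (UNIV :: 'a set) ^ card B"
  using assms
proof (induction B rule: finite_induct)
  case empty
  then show ?case by simp
next
  case (insert b B)
  have indep: "independent B" and b: "b \<notin> span B"
    using insert.prems insert.hyps by (auto simp: independent_insert)
  \<comment> \<open>Two different coefficients of \<open>b\<close> would, after division by
    \<open>k - l\<close>, put \<open>b\<close> into \<open>span B\<close>.\<close>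
  have scalar_unique: "k = l" if "x \<in> span B" "y \<in> span B" and eq: "x + scale k b = y + scale l b" for k l x y
  proof (rule ccontr)
    assume "k \<noteq> l"
    have "scale (k - l) b = y - x"
      using eq by (simp add: scale_left_diff_distrib algebra_simps)
    then have "scale (inverse (k - l)) (scale (k - l) b) \<in> span B"
      using that by (simp add: span_diff span_scale)
    with \<open>k \<noteq> l\<close> b show False by simp
  qed
  have inj: "inj_on (\<lambda>(k, x). x + scale k b) (UNIV \<times> span B)"
  proof (rule inj_onI, clarify)
    fix k x l y
    assume "x \<in> span B" "y \<in> span B" "x + scale k b = y + scale l b"
    moreover from this have "k = l"
      by (rule scalar_unique)
    ultimately show "k = l \<and> x = y"
      by simp
  qed
  show ?case
    using card_image[OF inj] insert.IH[OF indep] insert.hyps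
    by (simp add: span_insert_eq_image card_cartesian_product)
qed

lemma card_subspace:
  assumes "subspace A" "finite A"
  shows "card A = card (UNIV :: 'a set) ^ dim A"
proof -
  obtain B where B: "B \<subseteq> A" "independent B" "A \<subseteq> span B" "card B = dim A"
    using basis_exists .
  moreover have "span B = A"
    using B assms span_minimal by blast
  ultimately show ?thesis
    using card_span_independent finite_subset assms by metis
qed

text \<open>Cardinality is monotone, and it is a power of q > 1 with the dimension as
  exponent.\<close>

lemma dim_subset:
  assumes "subspace A" "subspace B" "A \<subseteq> B" "finite B"
  shows "dim A \<le> dim B"
  using assms card_mono[of B A] finite_subset[of A B] card_scalars_gt_1
  by (simp add: card_subspace)

text \<open>Counts along the addition map on \<open>A \<times> B\<close>: its image is the sum, and
  its kernel, the pairs \<open>(x, - x)\<close>, is a copy of \<open>A \<inter> B\<close>.\<close>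

lemma dim_sums_Int:
  assumes A: "subspace A" "finite A" and B: "subspace B" "finite B"
  shows "dim {a + b |a b. a \<in> A \<and> b \<in> B} + dim (A \<inter> B) = dim A + dim B"
proof -
  let ?f = "\<lambda>(a, b). a + b"
  let ?K = "{x \<in> A \<times> B. ?f x = 0}"
  have img: "?f ` (A \<times> B) = {a + b |a b. a \<in> A \<and> b \<in> B}"
    by auto
  have "bij_betw (\<lambda>x. (x, - x)) (A \<inter> B) ?K"
    by (rule bij_betw_byWitness[where f' = fst])
      (use A B in \<open>auto simp: subspace_neg add_eq_0_iff2 dest: subspace_neg\<close>)
  then have ker: "card ?K = card (A \<inter> B)"
    by (rule bij_betw_same_card[symmetric])
  have "card (A \<times> B) = card (?f ` (A \<times> B)) * card ?K"
    by (rule card_eq_card_image_times_card_kernel)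
      (use A B in \<open>auto simp: subspace_add subspace_diff\<close>)
  then have "card A * card B = card {a + b |a b. a \<in> A \<and> b \<in> B} * card (A \<inter> B)"
    by (simp only: img ker card_cartesian_product)
  moreover have "finite {a + b |a b. a \<in> A \<and> b \<in> B}"
    unfolding img[symmetric] using A B by simp
  ultimately have "card (UNIV :: 'a set) ^ (dim A + dim B) =
      card (UNIV :: 'a set) ^ (dim {a + b |a b. a \<in> A \<and> b \<in> B} + dim (A \<inter> B))"
    using A B by (simp add: card_subspace subspace_sums subspace_inter power_add)
  then show ?thesis
    by (simp only: power_inject_exp[OF card_scalars_gt_1])
qed

end

section \<open>Monotonicity and supermodularity of the nullity\<close>

context q_matroid
begin

sublocale finite_field_vector_space scale
  by unfold_locales

lemma finite_ground: "finite E"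
  using finite_dim_ground finite_span by blast

text \<open>With a complement C of \<open>A\<close> in \<open>B\<close>, submodularity bounds the
  growth of the rank from \<open>A\<close> to \<open>B\<close> by \<open>r C\<close>, hence by dim C
  = dim B - dim A.\<close>

lemma nullity_mono:
  assumes A: "V.subspace A" and B: "V.subspace B" and "A \<subseteq> B" "B \<subseteq> E"
  shows "nullity A \<le> nullity B"
proof -
  obtain X where X: "X \<subseteq> A" "V.independent X" "A \<subseteq> V.span X" "card X = V.dim A"
    using V.basis_exists .
  obtain Y where Y: "X \<subseteq> Y" "Y \<subseteq> B" "V.independent Y" "B \<subseteq> V.span Y"
    using V.maximal_independent_subset_extend[of X B] X assms by blast
  have spans: "V.span X = A" "V.span Y = B"
    using X Y A B V.span_minimal by blast+
  have fin: "finite Y"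
    using Y assms finite_ground by (meson finite_subset)
  \<comment> \<open>The vectors added when a basis of \<open>A\<close> is extended to one of
    \<open>B\<close> span the complement.\<close>
  let ?C = "V.span (Y - X)"
  have C: "V.subspace ?C" "?C \<subseteq> E"
    using spans V.span_mono[of "Y - X" Y] assms by auto
  have sum: "{a + c |a c. a \<in> A \<and> c \<in> ?C} = B"
    using V.span_Un[of X "Y - X"] spans Y by (simp add: Un_absorb1)
  have "int (V.dim ?C) = int (card Y) - int (card X)"
    using V.dim_span_eq_card_independent[of "Y - X"] V.independent_mono[OF Y(3), of "Y - X"]
      card_Diff_subset[of X Y] card_mono[OF fin Y(1)] finite_subset[OF Y(1) fin] Y by auto
  moreover have "card Y = V.dim B"
    using Y V.basis_card_eq_dim by blast
  moreover have "r B + r (A \<inter> ?C) \<le> r A + r ?C"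
    using R3[of A ?C] A C assms sum by auto
  moreover have "0 \<le> r (A \<inter> ?C)" "r ?C \<le> int (V.dim ?C)"
    using R1[of "A \<inter> ?C"] R1[of ?C] A C by (auto simp: V.subspace_inter)
  ultimately show ?thesis
    using X by (simp add: nullity_def)
qed

text \<open>The dimension is modular and the rank submodular, so their difference is
  supermodular.\<close>

lemma nullity_supermodular:
  assumes "V.subspace A" "V.subspace B" "A \<subseteq> E" "B \<subseteq> E"
  shows "nullity A + nullity B \<le> nullity {a + b |a b. a \<in> A \<and> b \<in> B} + nullity (A \<inter> B)"
proof -
  have "finite A" "finite B"
    using assms finite_ground finite_subset by blast+
  then have "V.dim {a + b |a b. a \<in> A \<and> b \<in> B} + V.dim (A \<inter> B) = V.dim A + V.dim B"
    using assms by (simp add: dim_sums_Int)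
  then show ?thesis
    using R3[of A B] assms by (simp add: nullity_def)
qed

end

section \<open>Slices and projections of subspaces of the direct sum\<close>

locale q_matroid_pair =
  M1: q_matroid s1 E1 r1 + M2: q_matroid s2 E2 r2
  for s1 :: "'a::{field,finite} \<Rightarrow> 'b::ab_group_add \<Rightarrow> 'b" and E1 r1
    and s2 :: "'a \<Rightarrow> 'c::ab_group_add \<Rightarrow> 'c" and E2 r2
begin

sublocale P: vector_space_prod s1 s2
  by unfold_locales

sublocale P: finite_field_vector_space P.scale
  by unfold_locales

text \<open>Leaving \<open>E1\<close> out makes the slice commute with intersections by definition;
  for \<open>A\<close> inside the direct sum \<open>fst_image_Int_embedding\<close> recovers the
  form used in the theorem.\<close>

definition fst_slice :: "('b \<times> 'c) set \<Rightarrow> 'b set"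
  where "fst_slice A = {x. (x, 0) \<in> A}"

definition free_product_rank :: "('b \<times> 'c) set \<Rightarrow> int"
  where "free_product_rank A =
    min (r1 E1 + r2 (snd ` A)) (r1 (fst_slice A) + int (M2.V.dim (snd ` A)))"

lemma fst_image_Int_embedding:
  assumes "A \<subseteq> E1 \<times> E2"
  shows "fst ` (A \<inter> (\<lambda>x. (x, 0)) ` E1) = fst_slice A"
  using assms by (force simp: fst_slice_def)

lemma subspace_fst_slice:
  assumes "P.p.subspace A"
  shows "M1.V.subspace (fst_slice A)"
  unfolding M1.V.subspace_def fst_slice_def
  using P.p.subspace_0[OF assms] P.p.subspace_add[OF assms, of "(_, 0)" "(_, 0)"]
    P.p.subspace_scale[OF assms, of "(_, 0)"]
  by (auto simp: P.scale_def zero_prod_def)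

lemma subspace_snd_image:
  assumes "P.p.subspace A"
  shows "M2.V.subspace (snd ` A)"
proof -
  interpret snd: Vector_Spaces.linear P.scale s2 snd
    by (rule P.linear_snd)
  show ?thesis
    using assms by (rule snd.subspace_image)
qed

lemma fst_slice_subset: "A \<subseteq> E1 \<times> E2 \<Longrightarrow> fst_slice A \<subseteq> E1"
  by (auto simp: fst_slice_def)

lemma snd_image_subset: "A \<subseteq> E1 \<times> E2 \<Longrightarrow> snd ` A \<subseteq> E2"
  by auto

lemma finite_ground_prod: "finite (E1 \<times> E2)"
  by (simp add: M1.finite_ground M2.finite_ground)

lemma subspace_ground_prod: "P.p.subspace (E1 \<times> E2)"
  by (intro P.subspace_Times M1.subspace_ground M2.subspace_ground)

text \<open>Rank-nullity for \<open>snd\<close> restricted to \<open>A\<close>, by counting: the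
  kernel is a copy of \<open>fst_slice A\<close>, and exponents of q are compared.\<close>

lemma dim_eq_dim_slice_plus_dim_image:
  assumes A: "P.p.subspace A" and sub: "A \<subseteq> E1 \<times> E2"
  shows "P.p.dim A = M1.V.dim (fst_slice A) + M2.V.dim (snd ` A)"
proof -
  let ?q = "card (UNIV :: 'a set)"
  have fin: "finite A" "finite (fst_slice A)" "finite (snd ` A)"
    using finite_subset[OF sub finite_ground_prod]
      finite_subset[OF fst_slice_subset[OF sub] M1.finite_ground] by auto
  have "{x \<in> A. snd x = 0} = (\<lambda>x. (x, 0)) ` fst_slice A"
    by (auto simp: fst_slice_def)
  then have ker: "card {x \<in> A. snd x = 0} = card (fst_slice A)"
    by (simp add: card_image inj_on_def)
  have "card A = card (snd ` A) * card {x \<in> A. snd x = 0}"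
    by (rule card_eq_card_image_times_card_kernel)
      (use A fin in \<open>auto simp: P.p.subspace_add P.p.subspace_diff\<close>)
  then have "?q ^ P.p.dim A = ?q ^ (M1.V.dim (fst_slice A) + M2.V.dim (snd ` A))"
    using ker fin A P.card_subspace[OF A fin(1)]
      M1.card_subspace[OF subspace_fst_slice[OF A] fin(2)]
      M2.card_subspace[OF subspace_snd_image[OF A] fin(3)]
    by (simp add: power_add)
  then show ?thesis
    by (simp only: power_inject_exp[OF M1.card_scalars_gt_1])
qed

section \<open>Submodularity of the two candidate ranks and the mixed inequality\<close>

lemma slice_rank_submodular:
  fixes h :: "('b \<times> 'c) set \<Rightarrow> int"
  defines "h \<equiv> \<lambda>A. r1 (fst_slice A) + int (M2.V.dim (snd ` A))"
  assumes A: "P.p.subspace A" "A \<subseteq> E1 \<times> E2" and B: "P.p.subspace B" "B \<subseteq> E1 \<times> E2"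
  shows "h {a + b |a b. a \<in> A \<and> b \<in> B} + h (A \<inter> B) \<le> h A + h B"
proof -
  let ?S = "{a + b |a b. a \<in> A \<and> b \<in> B}"
  let ?S1 = "{a + b |a b. a \<in> fst_slice A \<and> b \<in> fst_slice B}"
  note sub = P.p.subspace_sums[OF A(1) B(1)] P.p.subspace_inter[OF A(1) B(1)]
  have S: "?S \<subseteq> E1 \<times> E2"
    using A B P.p.subspace_add[OF subspace_ground_prod] by blast
  have AB: "A \<inter> B \<subseteq> E1 \<times> E2"
    using A by blast
  have h: "h X = int (P.p.dim X) - M1.nullity (fst_slice X)"
    if "P.p.subspace X" "X \<subseteq> E1 \<times> E2" for X
    using dim_eq_dim_slice_plus_dim_image[OF that] by (simp add: h_def M1.nullity_def)
  \<comment> \<open>The inclusion can be strict, since second components of elements of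
    \<open>A\<close> and \<open>B\<close> may cancel. Monotonicity of the nullity bridges the
    gap.\<close>
  have "?S1 \<subseteq> fst_slice ?S"
    by (force simp: fst_slice_def)
  then have "M1.nullity ?S1 \<le> M1.nullity (fst_slice ?S)"
    using subspace_fst_slice sub(1) A(1) B(1) fst_slice_subset[OF S]
    by (intro M1.nullity_mono M1.V.subspace_sums)
  moreover have "fst_slice (A \<inter> B) = fst_slice A \<inter> fst_slice B"
    by (auto simp: fst_slice_def)
  ultimately have "M1.nullity (fst_slice A) + M1.nullity (fst_slice B)
      \<le> M1.nullity (fst_slice ?S) + M1.nullity (fst_slice (A \<inter> B))"
    using M1.nullity_supermodular[of "fst_slice A" "fst_slice B"] A B
    by (simp add: subspace_fst_slice fst_slice_subset)
  moreover have "P.p.dim ?S + P.p.dim (A \<inter> B) = P.p.dim A + P.p.dim B"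
    using A B finite_subset[OF _ finite_ground_prod] by (intro P.dim_sums_Int) auto
  ultimately show ?thesis
    using h[OF A] h[OF B] h[OF sub(1) S] h[OF sub(2) AB] by linarith
qed

lemma snd_image_sums:
  "snd ` {a + b |a b. a \<in> A \<and> b \<in> B} = {a + b |a b. a \<in> snd ` A \<and> b \<in> snd ` B}"
proof (intro equalityI subsetI)
  fix z assume "z \<in> {a + b |a b. a \<in> snd ` A \<and> b \<in> snd ` B}"
  then obtain u v where "u \<in> A" "v \<in> B" "z = snd (u + v)"
    by auto
  then show "z \<in> snd ` {a + b |a b. a \<in> A \<and> b \<in> B}"
    by blast
next
  fix z assume "z \<in> snd ` {a + b |a b. a \<in> A \<and> b \<in> B}"
  then obtain u v where "u \<in> A" "v \<in> B" "z = snd u + snd v"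
    by auto
  then show "z \<in> {a + b |a b. a \<in> snd ` A \<and> b \<in> snd ` B}"
    by blast
qed

text \<open>In the second factor, R3 leaves the term \<open>r2 (snd\<close> A \<inter> snd
  \<open>B)\<close>; monotonicity of the nullity trades it for dimensions, and projecting
  \<open>A \<inter> B\<close> gives at most that intersection. In the first factor R2
  suffices.\<close>

lemma mixed_submodular:
  assumes A: "P.p.subspace A" "A \<subseteq> E1 \<times> E2" and B: "P.p.subspace B" "B \<subseteq> E1 \<times> E2"
  shows "(r1 E1 + r2 (snd ` {a + b |a b. a \<in> A \<and> b \<in> B}))
      + (r1 (fst_slice (A \<inter> B)) + int (M2.V.dim (snd ` (A \<inter> B))))
    \<le> (r1 E1 + r2 (snd ` A)) + (r1 (fst_slice B) + int (M2.V.dim (snd ` B)))"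
proof -
  note AB = P.p.subspace_inter[OF A(1) B(1)]
  note snds = subspace_snd_image[OF A(1)] subspace_snd_image[OF B(1)] subspace_snd_image[OF AB]
  have "r2 (snd ` {a + b |a b. a \<in> A \<and> b \<in> B}) + r2 (snd ` A \<inter> snd ` B)
      \<le> r2 (snd ` A) + r2 (snd ` B)"
    unfolding snd_image_sums using snds A B by (intro M2.R3) auto
  moreover have "M2.nullity (snd ` A \<inter> snd ` B) \<le> M2.nullity (snd ` B)"
    using snds B by (intro M2.nullity_mono M2.V.subspace_inter) auto
  moreover have "M2.V.dim (snd ` (A \<inter> B)) \<le> M2.V.dim (snd ` A \<inter> snd ` B)"
    using snds A finite_subset[OF snd_image_subset[OF A(2)] M2.finite_ground]
    by (intro M2.dim_subset M2.V.subspace_inter) auto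
  moreover have "r1 (fst_slice (A \<inter> B)) \<le> r1 (fst_slice B)"
    using subspace_fst_slice[OF AB] subspace_fst_slice[OF B(1)] fst_slice_subset[OF B(2)]
    by (intro M1.R2) (auto simp: fst_slice_def)
  ultimately show ?thesis
    by (simp add: M2.nullity_def)
qed

text \<open>This is submodularity of g, without the constant \<open>r1 E1\<close>. Projection need
  not commute with intersection, but one inclusion holds and R2 applies to it.\<close>

lemma snd_rank_submodular:
  assumes A: "P.p.subspace A" "A \<subseteq> E1 \<times> E2" and B: "P.p.subspace B" "B \<subseteq> E1 \<times> E2"
  shows "r2 (snd ` {a + b |a b. a \<in> A \<and> b \<in> B}) + r2 (snd ` (A \<inter> B))
    \<le> r2 (snd ` A) + r2 (snd ` B)"
proof -
  note snds = subspace_snd_image[OF A(1)] subspace_snd_image[OF B(1)]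
    subspace_snd_image[OF P.p.subspace_inter[OF A(1) B(1)]]
  have "r2 (snd ` {a + b |a b. a \<in> A \<and> b \<in> B}) + r2 (snd ` A \<inter> snd ` B)
      \<le> r2 (snd ` A) + r2 (snd ` B)"
    unfolding snd_image_sums using snds A B by (intro M2.R3) auto
  moreover have "r2 (snd ` (A \<inter> B)) \<le> r2 (snd ` A \<inter> snd ` B)"
    using snds A by (intro M2.R2 M2.V.subspace_inter) auto
  ultimately show ?thesis by linarith
qed

section \<open>Rank axioms and independent spaces of the direct sum\<close>

lemma q_matroid_free_product: "q_matroid P.scale (E1 \<times> E2) free_product_rank"
proof (unfold_locales, goal_cases)
  case 1
  show ?case by (rule subspace_ground_prod)
next
  case 2
  \<comment> \<open>Being finite, the ground space is its own finite spanning set.\<close>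
  show ?case
    using finite_ground_prod subspace_ground_prod P.p.span_eq_iff by blast
next
  case (3 A)
  have "0 \<le> r1 E1"
    using M1.R1[OF M1.subspace_ground] by simp
  moreover have "0 \<le> r1 (fst_slice A)" "r1 (fst_slice A) \<le> int (M1.V.dim (fst_slice A))"
    using M1.R1[OF subspace_fst_slice[OF 3(1)] fst_slice_subset[OF 3(2)]] by auto
  moreover have "0 \<le> r2 (snd ` A)"
    using M2.R1[OF subspace_snd_image[OF 3(1)] snd_image_subset[OF 3(2)]] by auto
  \<comment> \<open>The upper bound comes from the second entry of the minimum: bounding
    \<open>r1 (fst_slice A)\<close> by a dimension turns it into dim A.\<close>
  ultimately show ?case
    using dim_eq_dim_slice_plus_dim_image[OF 3] by (simp add: free_product_rank_def min_def)
next
  case (4 A B)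
  have "r1 (fst_slice A) \<le> r1 (fst_slice B)"
    using 4 by (intro M1.R2 subspace_fst_slice fst_slice_subset) (auto simp: fst_slice_def)
  moreover have "r2 (snd ` A) \<le> r2 (snd ` B)"
    using 4 by (intro M2.R2 subspace_snd_image snd_image_subset image_mono)
  moreover have "M2.V.dim (snd ` A) \<le> M2.V.dim (snd ` B)"
    using 4 finite_subset[OF snd_image_subset[OF 4(4)] M2.finite_ground]
    by (intro M2.dim_subset subspace_snd_image image_mono)
  ultimately show ?case
    by (simp add: free_product_rank_def min_def)
next
  case (5 A B)
  \<comment> \<open>If the minima for \<open>A\<close> and \<open>B\<close> are attained by the same
    entry, submodularity of that entry applies; otherwise the mixed inequality does, in either order
    of \<open>A\<close> and \<open>B\<close>, for which the sum must be recognised as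
    symmetric.\<close>
  have "{a + b |a b. a \<in> B \<and> b \<in> A} = {a + b |a b. a \<in> A \<and> b \<in> B}"
    by (metis (no_types, opaque_lifting) add.commute)
  then show ?case
    using slice_rank_submodular[OF 5(1,3,2,4)] snd_rank_submodular[OF 5(1,3,2,4)]
      mixed_submodular[OF 5(1,3,2,4)] mixed_submodular[OF 5(2,4,1,3)]
    by (simp add: free_product_rank_def min_def Int_commute)
qed

text \<open>The entry h never exceeds dim A, with equality exactly when the slice is independent.
  Given that, g reaching dim A is the inequality between conullity and nullity, rearranged.\<close>

lemma free_product_rank_eq_dim_iff:
  assumes "P.p.subspace A" "A \<subseteq> E1 \<times> E2"
  shows "free_product_rank A = int (P.p.dim A) \<longleftrightarrow>
    fst_slice A \<in> M1.indep_spaces \<and> M2.nullity (snd ` A) \<le> M1.conullity (fst_slice A)"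
proof -
  have "r1 (fst_slice A) \<le> int (M1.V.dim (fst_slice A))"
    using M1.R1[OF subspace_fst_slice fst_slice_subset] assms by blast
  then show ?thesis
    using subspace_fst_slice[OF assms(1)] fst_slice_subset[OF assms(2)]
      dim_eq_dim_slice_plus_dim_image[OF assms]
    by (auto simp: free_product_rank_def M1.indep_spaces_def M2.nullity_def M1.conullity_def
        min_def split: if_splits)
qed

end

theorem theorem3p4:
  fixes s1 :: "'a::{field,finite} \<Rightarrow> 'b::ab_group_add \<Rightarrow> 'b"
    and s2 :: "'a \<Rightarrow> 'c::ab_group_add \<Rightarrow> 'c"
    and E1 :: "'b set" and E2 :: "'c set"
    and r1 :: "'b set \<Rightarrow> int" and r2 :: "'c set \<Rightarrow> int"
  assumes "q_matroid s1 E1 r1" and "q_matroid s2 E2 r2"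
  shows "\<exists>r. q_matroid (module_prod.scale s1 s2) (E1 \<times> E2) r \<and>
           q_matroid.indep_spaces (module_prod.scale s1 s2) (E1 \<times> E2) r =
             {I. module.subspace (module_prod.scale s1 s2) I \<and> I \<subseteq> E1 \<times> E2 \<and>
                 fst ` (I \<inter> (\<lambda>x. (x, 0)) ` E1) \<in> q_matroid.indep_spaces s1 E1 r1 \<and>
                 q_matroid.conullity E1 r1 (fst ` (I \<inter> (\<lambda>x. (x, 0)) ` E1))
                   \<ge> q_matroid.nullity s2 r2 (snd ` I)}"
proof -
  interpret q_matroid_pair s1 E1 r1 s2 E2 r2
    using assms by (rule q_matroid_pair.intro)
  show ?thesis
    by (intro exI[of _ free_product_rank] conjI q_matroid_free_product)
      (auto simp: q_matroid.indep_spaces_def[OF q_matroid_free_product]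
        fst_image_Int_embedding free_product_rank_eq_dim_iff)
qed

end
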